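(* Let $K$ be a field and let $H=(H^0,H^1,s,r)$ be a hypergraph such that $|s(h)|\geq 2$ and $|r(h)|\geq 2$ for any $h\in H^1$, and suppose that $H^1\neq\emptyset$. Then the Leavitt path algebra $L_K(H)$ is not von Neumann regular.
   Context: Algebras are associative but not necessarily unital. A multiset over a set $Y$ is a function $M:Y\to\mathbb N_0$; its support is $M_{\mathrm{supp}}=\{y\in Y\mid M(y)>0\}$. $\mathrm{Mult}(Y)$ is the set of multisets over $Y$ with finite, nonempty support, and $|M|=\sum_{y\in M_{\mathrm{supp}}}M(y)$. A (directed) hypergraph is a quadruple $H=(H^0,H^1,s,r)$ where $H^0,H^1$ are sets and $s,r:H^1\to\mathrm{Mult}(H^0)$ are maps. All hypergraphs are assumed nonempty (not $H^0=H^1=\emptyset$). For each $h\in H^1$ fix listings with multiplicity $s(h)=\{s(h)_1,\dots,s(h)_{|s(h)|}\}$ and $r(h)=\{r(h)_1,\dots,r(h)_{|r(h)|}\}$. The Leavitt path algebra $L_K(H)$ is the (not necessarily unital) $K$-algebra presented by the generators $v,h_{ij},h_{ij}^*$ ($v\in H^0$, $h\in H^1$, $1\le i\le|s(h)|$, $1\le j\le|r(h)|$) and the relations: (i) $uv=\delta_{uv}u$ ($u,v\in H^0$); (ii) $s(h)_ih_{ij}=h_{ij}=h_{ij}r(h)_j$ and $r(h)_jh_{ij}^*=h_{ij}^*=h_{ij}^*s(h)_i$ for all $h,i,j$; (iii) $\sum_{k=1}^{|r(h)|}h_{ik}h_{jk}^*=\delta_{ij}s(h)_i$ ($h\in H^1$,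 $1\le i,j\le|s(h)|$); (iv) $\sum_{k=1}^{|s(h)|}h_{ki}^*h_{kj}=\delta_{ij}r(h)_i$ ($h\in H^1$, $1\le i,j\le|r(h)|$). A ring $R$ is von Neumann regular if for any $x\in R$ there is a $y\in R$ such that $xyx=x$. *)

theory Defs
  imports Complex_Main "HOL-Library.Multiset" "HOL-Library.Poly_Mapping" "HOL-Library.Set_Algebras"
begin

section \<open>Associative, not necessarily unital algebras\<close>

record ('k, 'a) nu_algebra =
  acarrier :: "'a set"
  aadd :: "'a \<Rightarrow> 'a \<Rightarrow> 'a"
  azero :: 'a
  amult :: "'a \<Rightarrow> 'a \<Rightarrow> 'a"
  asmult :: "'k \<Rightarrow> 'a \<Rightarrow> 'a"

locale nonunital_algebra =
  fixes R :: "('k::field, 'a) nu_algebra"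
  assumes add_closed: "\<lbrakk>x \<in> acarrier R; y \<in> acarrier R\<rbrakk> \<Longrightarrow> aadd R x y \<in> acarrier R"
    and zero_closed: "azero R \<in> acarrier R"
    and mult_closed: "\<lbrakk>x \<in> acarrier R; y \<in> acarrier R\<rbrakk> \<Longrightarrow> amult R x y \<in> acarrier R"
    and smult_closed: "x \<in> acarrier R \<Longrightarrow> asmult R c x \<in> acarrier R"
    and add_assoc: "\<lbrakk>x \<in> acarrier R; y \<in> acarrier R; z \<in> acarrier R\<rbrakk>
      \<Longrightarrow> aadd R (aadd R x y) z = aadd R x (aadd R y z)"
    and add_commute: "\<lbrakk>x \<in> acarrier R; y \<in> acarrier R\<rbrakk> \<Longrightarrow> aadd R x y = aadd R y x"
    and add_zero: "x \<in> acarrier R \<Longrightarrow> aadd R x (azero R) = x"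
    and add_inverse: "x \<in> acarrier R \<Longrightarrow> \<exists>y\<in>acarrier R. aadd R x y = azero R"
    and mult_assoc: "\<lbrakk>x \<in> acarrier R; y \<in> acarrier R; z \<in> acarrier R\<rbrakk>
      \<Longrightarrow> amult R (amult R x y) z = amult R x (amult R y z)"
    and distrib_left: "\<lbrakk>x \<in> acarrier R; y \<in> acarrier R; z \<in> acarrier R\<rbrakk>
      \<Longrightarrow> amult R x (aadd R y z) = aadd R (amult R x y) (amult R x z)"
    and distrib_right: "\<lbrakk>x \<in> acarrier R; y \<in> acarrier R; z \<in> acarrier R\<rbrakk>
      \<Longrightarrow> amult R (aadd R x y) z = aadd R (amult R x z) (amult R y z)"
    and smult_one: "x \<in> acarrier R \<Longrightarrow> asmult R 1 x = x"
    and smult_smult: "x \<in> acarrier R \<Longrightarrow> asmult R c (asmult R d x) = asmult R (c * d) x"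
    and smult_add_left: "x \<in> acarrier R
      \<Longrightarrow> asmult R (c + d) x = aadd R (asmult R c x) (asmult R d x)"
    and smult_add_right: "\<lbrakk>x \<in> acarrier R; y \<in> acarrier R\<rbrakk>
      \<Longrightarrow> asmult R c (aadd R x y) = aadd R (asmult R c x) (asmult R c y)"
    and smult_mult_left: "\<lbrakk>x \<in> acarrier R; y \<in> acarrier R\<rbrakk>
      \<Longrightarrow> amult R (asmult R c x) y = asmult R c (amult R x y)"
    and smult_mult_right: "\<lbrakk>x \<in> acarrier R; y \<in> acarrier R\<rbrakk>
      \<Longrightarrow> amult R x (asmult R c y) = asmult R c (amult R x y)"

definition von_neumann_regular :: "('k, 'a) nu_algebra \<Rightarrow> bool" where
  "von_neumann_regular R \<longleftrightarrow>
     (\<forall>x\<in>acarrier R. \<exists>y\<in>acarrier R. amult R (amult R x y) x = x)"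


section \<open>Presentations of algebras\<close>

text \<open>Words form an additively written monoid, so that \<open>'x word \<Rightarrow>\<^sub>0 'k\<close> with the
  convolution product of the library is the free unital algebra \<open>K\<langle>x\<rangle>\<close>.\<close>

datatype 'x word = Word (letters: "'x list")

instantiation word :: (type) monoid_add
begin

definition zero_word :: "'a word" where
  "zero_word = Word []"

definition plus_word :: "'a word \<Rightarrow> 'a word \<Rightarrow> 'a word" where
  "plus_word u w = Word (letters u @ letters w)"

instance
  by standard (simp_all add: zero_word_def plus_word_def)

end

definition generator :: "'x \<Rightarrow> 'x word \<Rightarrow>\<^sub>0 'k::field" where
  "generator x = Poly_Mapping.single (Word [x]) 1"

definition scale :: "'k::field \<Rightarrow> ('x word \<Rightarrow>\<^sub>0 'k) \<Rightarrow> 'x word \<Rightarrow>\<^sub>0 'k" where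
  "scale c p = Poly_Mapping.map ((*) c) p"

text \<open>The free non-unital algebra on \<open>X\<close>: no constant term.\<close>

definition free_algebra :: "'x set \<Rightarrow> ('x word \<Rightarrow>\<^sub>0 'k::field) set" where
  "free_algebra X = {p. \<forall>w\<in>Poly_Mapping.keys p. letters w \<noteq> [] \<and> set (letters w) \<subseteq> X}"

definition algebra_ideal :: "('x word \<Rightarrow>\<^sub>0 'k::field) set \<Rightarrow> ('x word \<Rightarrow>\<^sub>0 'k) set \<Rightarrow> bool" where
  "algebra_ideal A I \<longleftrightarrow> I \<subseteq> A \<and> 0 \<in> I \<and>
     (\<forall>a\<in>I. \<forall>b\<in>I. a + b \<in> I) \<and> (\<forall>c. \<forall>a\<in>I. scale c a \<in> I) \<and>
     (\<forall>a\<in>A. \<forall>b\<in>I. a * b \<in> I \<and> b * a \<in> I)"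

text \<open>Elements of the quotient are the cosets \<open>a + I\<close>. Adding \<open>I\<close> to a product set completes it
  to a full coset: \<open>(a + I) (b + I) + I = a b + I\<close>, and similarly for scalar multiples.\<close>

definition quotient_algebra ::
  "('x word \<Rightarrow>\<^sub>0 'k::field) set \<Rightarrow> ('x word \<Rightarrow>\<^sub>0 'k) set \<Rightarrow> ('k, ('x word \<Rightarrow>\<^sub>0 'k) set) nu_algebra"
where
  "quotient_algebra A I =
    \<lparr>acarrier = (\<lambda>a. a +o I) ` A,
     aadd = (\<lambda>P Q. P + Q),
     azero = I,
     amult = (\<lambda>P Q. P * Q + I),
     asmult = (\<lambda>c P. scale c ` P + I)\<rparr>"

definition presented_algebra ::
  "'x set \<Rightarrow> ('x word \<Rightarrow>\<^sub>0 'k::field) set \<Rightarrow> ('k, ('x word \<Rightarrow>\<^sub>0 'k) set) nu_algebra"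
where
  "presented_algebra X S =
     quotient_algebra (free_algebra X) (algebra_ideal (free_algebra X) hull S)"


section \<open>Hypergraphs and their Leavitt path algebras\<close>

record ('v, 'e) hypergraph_data =
  hverts :: "'v set"
  hedges :: "'e set"
  hsource :: "'e \<Rightarrow> 'v multiset"
  hrange :: "'e \<Rightarrow> 'v multiset"

text \<open>Library multisets have finite support; \<open>size\<close> is the cardinality \<open>|M|\<close>.\<close>

definition Mult :: "'v set \<Rightarrow> 'v multiset set" where
  "Mult Y = {M. M \<noteq> {#} \<and> set_mset M \<subseteq> Y}"

locale hypergraph =
  fixes H :: "('v, 'e) hypergraph_data"
  assumes source_Mult: "h \<in> hedges H \<Longrightarrow> hsource H h \<in> Mult (hverts H)"
    and range_Mult: "h \<in> hedges H \<Longrightarrow> hrange H h \<in> Mult (hverts H)"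
    and nonempty: "hverts H \<noteq> {} \<or> hedges H \<noteq> {}"

text \<open>A choice, for every hyperedge, of listings with multiplicity of its source and range.
  Positions are counted from \<open>0\<close>, so \<open>s(h)\<^sub>i\<close> with \<open>1 \<le> i \<le> |s(h)|\<close> is
  \<open>sl h ! (i - 1)\<close>; the index ranges of the generators are shifted accordingly.\<close>

locale listed_hypergraph = hypergraph H
  for H :: "('v, 'e) hypergraph_data" +
  fixes sl rl :: "'e \<Rightarrow> 'v list"
  assumes source_listing: "h \<in> hedges H \<Longrightarrow> mset (sl h) = hsource H h"
    and range_listing: "h \<in> hedges H \<Longrightarrow> mset (rl h) = hrange H h"

datatype ('v, 'e) lpa_gen = Vertex 'v | Edge 'e nat nat | Ghost 'e nat nat

definition lpa_generators :: "('v, 'e) hypergraph_data \<Rightarrow> ('v, 'e) lpa_gen set" where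
  "lpa_generators H = Vertex ` hverts H \<union>
     {Edge h i j | h i j. h \<in> hedges H \<and> i < size (hsource H h) \<and> j < size (hrange H h)} \<union>
     {Ghost h i j | h i j. h \<in> hedges H \<and> i < size (hsource H h) \<and> j < size (hrange H h)}"

abbreviation vert :: "'v \<Rightarrow> ('v, 'e) lpa_gen word \<Rightarrow>\<^sub>0 'k::field" where
  "vert v \<equiv> generator (Vertex v)"

abbreviation edge :: "'e \<Rightarrow> nat \<Rightarrow> nat \<Rightarrow> ('v, 'e) lpa_gen word \<Rightarrow>\<^sub>0 'k::field" where
  "edge h i j \<equiv> generator (Edge h i j)"

abbreviation ghost :: "'e \<Rightarrow> nat \<Rightarrow> nat \<Rightarrow> ('v, 'e) lpa_gen word \<Rightarrow>\<^sub>0 'k::field" where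
  "ghost h i j \<equiv> generator (Ghost h i j)"

text \<open>A relation \<open>p = q\<close> is represented by the element \<open>p - q\<close>.\<close>

inductive_set lpa_relations ::
  "('v, 'e) hypergraph_data \<Rightarrow> ('e \<Rightarrow> 'v list) \<Rightarrow> ('e \<Rightarrow> 'v list) \<Rightarrow>
     (('v, 'e) lpa_gen word \<Rightarrow>\<^sub>0 'k::field) set"
  for H :: "('v, 'e) hypergraph_data" and sl rl :: "'e \<Rightarrow> 'v list"
where
  vertices: "\<lbrakk>u \<in> hverts H; v \<in> hverts H\<rbrakk>
    \<Longrightarrow> vert u * vert v - (if u = v then vert u else 0) \<in> lpa_relations H sl rl"
| source_edge: "\<lbrakk>h \<in> hedges H; i < size (hsource H h); j < size (hrange H h)\<rbrakk>
    \<Longrightarrow> vert (sl h ! i) * edge h i j - edge h i j \<in> lpa_relations H sl rl"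
| edge_range: "\<lbrakk>h \<in> hedges H; i < size (hsource H h); j < size (hrange H h)\<rbrakk>
    \<Longrightarrow> edge h i j * vert (rl h ! j) - edge h i j \<in> lpa_relations H sl rl"
| range_ghost: "\<lbrakk>h \<in> hedges H; i < size (hsource H h); j < size (hrange H h)\<rbrakk>
    \<Longrightarrow> vert (rl h ! j) * ghost h i j - ghost h i j \<in> lpa_relations H sl rl"
| ghost_source: "\<lbrakk>h \<in> hedges H; i < size (hsource H h); j < size (hrange H h)\<rbrakk>
    \<Longrightarrow> ghost h i j * vert (sl h ! i) - ghost h i j \<in> lpa_relations H sl rl"
| edge_ghost: "\<lbrakk>h \<in> hedges H; i < size (hsource H h); j < size (hsource H h)\<rbrakk>
    \<Longrightarrow> (\<Sum>k<size (hrange H h). edge h i k * ghost h j k) -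
         (if i = j then vert (sl h ! i) else 0) \<in> lpa_relations H sl rl"
| ghost_edge: "\<lbrakk>h \<in> hedges H; i < size (hrange H h); j < size (hrange H h)\<rbrakk>
    \<Longrightarrow> (\<Sum>k<size (hsource H h). ghost h k i * edge h k j) -
         (if i = j then vert (rl h ! i) else 0) \<in> lpa_relations H sl rl"

definition leavitt_path_algebra ::
  "'k::field itself \<Rightarrow> ('v, 'e) hypergraph_data \<Rightarrow> ('e \<Rightarrow> 'v list) \<Rightarrow> ('e \<Rightarrow> 'v list) \<Rightarrow>
     ('k, (('v, 'e) lpa_gen word \<Rightarrow>\<^sub>0 'k) set) nu_algebra"
where
  "leavitt_path_algebra K H sl rl = presented_algebra (lpa_generators H) (lpa_relations H sl rl)"


section \<open>Well-definedness\<close>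

lemma scale_conv_mult: "scale c p = Poly_Mapping.single 0 c * p"
  by (simp add: scale_def mult_map_scale_conv_mult)

lemma lookup_scale [simp]: "Poly_Mapping.lookup (scale c p) w = c * Poly_Mapping.lookup p w"
  unfolding scale_def by (simp add: Poly_Mapping.map.rep_eq when_def)

lemma scale_add_right: "scale c (p + q) = scale c p + scale c q"
  by (simp add: scale_conv_mult distrib_left)

lemma scale_add_left: "scale (c + d) p = scale c p + scale d p"
  by (rule poly_mapping_eqI) (simp add: lookup_add algebra_simps)

lemma scale_scale: "scale c (scale d p) = scale (c * d) p"
  by (rule poly_mapping_eqI) simp

lemma scale_one [simp]: "scale 1 p = p"
  by (rule poly_mapping_eqI) simp

lemma scale_minus_one: "scale (- 1) p = - p"
  by (rule poly_mapping_eqI) simp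

lemma scale_mult_left: "scale c p * q = scale c (p * q)"
  by (simp add: scale_conv_mult mult.assoc)

lemma single_zero_mult_commute:
  "p * Poly_Mapping.single 0 c = Poly_Mapping.single 0 c * p"
  for p :: "'x word \<Rightarrow>\<^sub>0 'k::field"
proof (induction p rule: update_induct)
  case const
  then show ?case by simp
next
  case (update f a b)
  have "Poly_Mapping.update a b f = f + Poly_Mapping.single a b"
    using update.hyps
    by (intro poly_mapping_eqI)
      (auto simp: lookup_update lookup_add lookup_single in_keys_iff when_def)
  with update.IH show ?case
    by (simp add: distrib_left distrib_right mult_single mult.commute)
qed

lemma scale_mult_right: "p * scale c q = scale c (p * q)"
  unfolding scale_conv_mult mult.assoc[symmetric] single_zero_mult_commute ..

lemma free_algebra_zero: "0 \<in> free_algebra X"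
  by (simp add: free_algebra_def)

lemma free_algebra_add: "\<lbrakk>p \<in> free_algebra X; q \<in> free_algebra X\<rbrakk> \<Longrightarrow> p + q \<in> free_algebra X"
  using keys_add[of p q] unfolding free_algebra_def by blast

lemma free_algebra_scale: "p \<in> free_algebra X \<Longrightarrow> scale c p \<in> free_algebra X"
  unfolding free_algebra_def by (auto simp: in_keys_iff)

lemma free_algebra_uminus: "p \<in> free_algebra X \<Longrightarrow> - p \<in> free_algebra X"
  using free_algebra_scale[of p X "- 1"] by (simp add: scale_minus_one)

lemma free_algebra_diff: "\<lbrakk>p \<in> free_algebra X; q \<in> free_algebra X\<rbrakk> \<Longrightarrow> p - q \<in> free_algebra X"
  using free_algebra_add[of p X "- q"] free_algebra_uminus[of q X] by simp

lemma free_algebra_mult: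
  assumes "p \<in> free_algebra X" and "q \<in> free_algebra X"
  shows "p * q \<in> free_algebra X"
  using assms keys_mult[of p q] unfolding free_algebra_def plus_word_def by fastforce

lemma free_algebra_sum: "(\<And>i. i \<in> S \<Longrightarrow> f i \<in> free_algebra X) \<Longrightarrow> sum f S \<in> free_algebra X"
  by (induction S rule: infinite_finite_induct) (auto simp: free_algebra_zero free_algebra_add)

lemma free_algebra_generator: "x \<in> X \<Longrightarrow> generator x \<in> free_algebra X"
  by (simp add: free_algebra_def generator_def)

lemma algebra_ideal_self: "algebra_ideal (free_algebra X) (free_algebra X)"
  by (simp add: algebra_ideal_def free_algebra_zero free_algebra_add free_algebra_scale
      free_algebra_mult)

lemma algebra_ideal_hull:
  assumes "S \<subseteq> free_algebra X"
  shows "algebra_ideal (free_algebra X) (algebra_ideal (free_algebra X) hull S)"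
proof -
  have "algebra_ideal (free_algebra X) hull S \<subseteq> free_algebra X"
    using assms algebra_ideal_self by (rule hull_minimal)
  then show ?thesis
    unfolding algebra_ideal_def[of _ "_ hull S"]
    by (auto simp: hull_def) (auto simp: algebra_ideal_def)
qed

lemma nonunital_algebra_quotient:
  fixes X :: "'x set" and I :: "('x word \<Rightarrow>\<^sub>0 'k::field) set"
  assumes I: "algebra_ideal (free_algebra X) I"
  shows "nonunital_algebra (quotient_algebra (free_algebra X) I)"
proof -
  let ?A = "free_algebra X :: ('x word \<Rightarrow>\<^sub>0 'k) set"
  have zero: "0 \<in> I" and add: "\<And>a b. a \<in> I \<Longrightarrow> b \<in> I \<Longrightarrow> a + b \<in> I"
    and sc: "\<And>c a. a \<in> I \<Longrightarrow> scale c a \<in> I" and sub: "\<And>a. a \<in> I \<Longrightarrow> a \<in> ?A"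
    and ml: "\<And>a b. a \<in> ?A \<Longrightarrow> b \<in> I \<Longrightarrow> a * b \<in> I"
    and mr: "\<And>a b. a \<in> ?A \<Longrightarrow> b \<in> I \<Longrightarrow> b * a \<in> I"
    using I by (auto simp: algebra_ideal_def)
  have mem: "x \<in> a +o I \<longleftrightarrow> (\<exists>i\<in>I. x = a + i)" for a x
    by (auto simp: elt_set_plus_def)
  have cadd: "(a +o I) + (b +o I) = (a + b) +o I" for a b
  proof (intro set_eqI iffI)
    fix x assume "x \<in> (a +o I) + (b +o I)"
    then obtain i j where "i \<in> I" "j \<in> I" "x = (a + i) + (b + j)"
      by (auto simp: set_plus_def elt_set_plus_def)
    then show "x \<in> (a + b) +o I"
      unfolding mem by (intro bexI[of _ "i + j"]) (auto simp: algebra_simps add)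
  next
    fix x assume "x \<in> (a + b) +o I"
    then obtain i where i: "i \<in> I" "x = (a + 0) + (b + i)"
      by (auto simp: mem algebra_simps)
    then show "x \<in> (a +o I) + (b +o I)"
      using zero mem by (metis set_plus_intro)
  qed
  have cmul: "(a +o I) * (b +o I) + I = (a * b) +o I" if "a \<in> ?A" "b \<in> ?A" for a b
  proof (intro set_eqI iffI)
    fix x assume "x \<in> (a +o I) * (b +o I) + I"
    then obtain i j k where *: "i \<in> I" "j \<in> I" "k \<in> I" "x = (a + i) * (b + j) + k"
      by (auto simp: set_plus_def set_times_def elt_set_plus_def)
    then have "a * j + i * b + i * j + k \<in> I"
      using that by (blast intro: add ml mr sub)
    moreover have "x = a * b + (a * j + i * b + i * j + k)"
      using * by (simp add: algebra_simps)
    ultimately show "x \<in> (a * b) +o I" unfolding mem by blast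
  next
    fix x assume "x \<in> (a * b) +o I"
    then obtain i where "i \<in> I" "x = (a + 0) * (b + 0) + i" by (auto simp: mem)
    then show "x \<in> (a +o I) * (b +o I) + I"
      using zero mem by (metis set_plus_intro set_times_intro)
  qed
  have csc: "scale c ` (a +o I) + I = scale c a +o I" for c a
  proof (intro set_eqI iffI)
    fix x assume "x \<in> scale c ` (a +o I) + I"
    then obtain i k where *: "i \<in> I" "k \<in> I" "x = scale c (a + i) + k"
      by (auto simp: set_plus_def elt_set_plus_def)
    then show "x \<in> scale c a +o I"
      unfolding mem
      by (intro bexI[of _ "scale c i + k"]) (auto simp: scale_add_right algebra_simps add sc)
  next
    fix x assume "x \<in> scale c a +o I"
    then obtain i where "i \<in> I" "x = scale c (a + 0) + i" by (auto simp: mem)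
    then show "x \<in> scale c ` (a +o I) + I"
      using zero mem by (metis set_plus_intro imageI)
  qed
  have czero: "I = 0 +o I" by (simp add: elt_set_plus_def)
  have cadd0: "(a +o I) + I = a +o I" for a
    using cadd[of a 0] czero by simp
  note closed = free_algebra_zero free_algebra_add free_algebra_mult free_algebra_scale
  show ?thesis
  proof (unfold_locales, goal_cases)
    case 2
    then show ?case
      using imageI[OF free_algebra_zero, of "\<lambda>a. a +o I" X] czero
      by (simp add: quotient_algebra_def)
  next
    case (8 x)
    then obtain a where a: "a \<in> ?A" "x = a +o I" by (auto simp: quotient_algebra_def)
    have "(a +o I) + (- a +o I) = I" using cadd[of a "- a"] czero by simp
    then show ?case
      using a free_algebra_uminus[OF a(1)] by (fastforce simp: quotient_algebra_def)
  qed ((clarsimp simp: quotient_algebra_def cadd cmul csc cadd0 closed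
        scale_add_right scale_scale scale_mult_left scale_mult_right;
        simp add: closed imageI scale_add_left algebra_simps)+)
qed

lemma (in listed_hypergraph) lpa_relations_subset:
  "lpa_relations H sl rl \<subseteq> (free_algebra (lpa_generators H) :: (_ \<Rightarrow>\<^sub>0 'k::field) set)"
proof
  have sv: "sl h ! i \<in> hverts H" if "h \<in> hedges H" "i < size (hsource H h)" for h i
    using that source_Mult[of h] source_listing[of h]
    by (metis (mono_tags, lifting) Mult_def mem_Collect_eq nth_mem set_mset_mset size_mset subsetD)
  have rv: "rl h ! i \<in> hverts H" if "h \<in> hedges H" "i < size (hrange H h)" for h i
    using that range_Mult[of h] range_listing[of h]
    by (metis (mono_tags, lifting) Mult_def mem_Collect_eq nth_mem set_mset_mset size_mset subsetD)
  fix p :: "(_, _) lpa_gen word \<Rightarrow>\<^sub>0 'k"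
  assume "p \<in> lpa_relations H sl rl"
  then show "p \<in> free_algebra (lpa_generators H)"
    by cases
      (auto intro!: free_algebra_diff free_algebra_sum free_algebra_mult free_algebra_generator
        free_algebra_zero simp: lpa_generators_def sv rv)
qed

lemma (in listed_hypergraph) nonunital_algebra_lpa:
  "nonunital_algebra (leavitt_path_algebra K H sl rl)"
  unfolding leavitt_path_algebra_def presented_algebra_def
  by (intro nonunital_algebra_quotient algebra_ideal_hull lpa_relations_subset)

end

(* Let F be the K[t]-module of all sequences over K[t]. Since F is isomorphic to F^k for every
   k > 0, a hyperedge with |s(h)| = m >= 2 and |r(h)| = n >= 2 can be represented by an m x n matrix
   of endomorphisms of F that is, up to the isomorphisms F^(m-1) = F = F^(n-1), the invertible
   2 x 2 matrix with rows (t, 1) and (1, 0). Doing this at all hyperedges gives a K[t]-linear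
   representation of L_K(H) on the product of copies of F indexed by the vertices, in which the
   generator x = h_11 acts between two factors as multiplication by t. A y with x y x = x
   would give t = t^2 q for some q in K[t]. *)

theory Submission
  imports Defs "HOL-Library.Function_Algebras" "HOL-Computational_Algebra.Polynomial"
begin

section \<open>Linear representations of free algebras\<close>

lemma poly_mapping_add_induct [case_names zero single add]:
  assumes "P 0" and "\<And>k c. P (Poly_Mapping.single k c)"
    and "\<And>p q. P p \<Longrightarrow> P q \<Longrightarrow> P (p + q)"
  shows "P (p :: 'a \<Rightarrow>\<^sub>0 'b::comm_monoid_add)"
proof (induction p rule: update_induct)
  case const
  show ?case by (rule assms)
next
  case (update f a b)
  have "Poly_Mapping.update a b f = f + Poly_Mapping.single a b"
    using update.hyps
    by (intro poly_mapping_eqI)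
      (auto simp: lookup_update lookup_add lookup_single in_keys_iff when_def)
  with update.IH show ?case by (simp add: assms)
qed

text \<open>The operators are linear over K[t], not merely over K, so that t can later be moved past
  the action of any element of the algebra.\<close>

locale poly_module_rep = module scl
  for scl :: "'k::field poly \<Rightarrow> 'm::ab_group_add \<Rightarrow> 'm" +
  fixes act :: "'x \<Rightarrow> 'm \<Rightarrow> 'm"
  assumes act_hom: "module_hom scl scl (act x)"
begin

text \<open>The action extended to the free unital algebra, with K acting through constant
  polynomials. With \<open>foldr\<close> the leftmost letter acts last, so products become
  compositions.\<close>

definition eval :: "('x word \<Rightarrow>\<^sub>0 'k) \<Rightarrow> 'm \<Rightarrow> 'm" where
  "eval p f = (\<Sum>w\<in>Poly_Mapping.keys p.
     scl [:Poly_Mapping.lookup p w:] (foldr act (letters w) f))"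

lemma foldr_act_hom: "module_hom scl scl (foldr act xs)"
proof (induction xs)
  case Nil
  show ?case by (simp add: module_hom_ident)
next
  case (Cons x xs)
  then show ?case
    unfolding foldr.simps using act_hom by (rule module_hom_compose)
qed

lemma eval_hom: "module_hom scl scl (eval p)"
proof -
  interpret module_pair scl scl ..
  have "module_hom scl scl (\<lambda>f. scl c (foldr act (letters w) f))" for c w
    using module_hom_compose[OF foldr_act_hom module_hom_scale_self[of c]] by (simp add: comp_def)
  then show ?thesis
    unfolding eval_def by (intro module_hom_sum) (simp_all add: module_axioms)
qed

lemma eval_zero: "eval 0 f = 0"
  by (simp add: eval_def)

lemma eval_add: "eval (p + q) f = eval p f + eval q f"
  unfolding eval_def
  by (rule setsum_keys_plus_distrib) (simp_all flip: scale_left_distrib)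

lemma eval_single: "eval (Poly_Mapping.single w c) f = scl [:c:] (foldr act (letters w) f)"
  by (simp add: eval_def)

lemma eval_generator: "eval (generator x) f = act x f"
  by (simp add: generator_def eval_single flip: one_pCons)

text \<open>Both sides are additive in \<open>p\<close> and in \<open>q\<close>, which leaves
  monomials: there words concatenate and scalars pass through the linear operators.\<close>

lemma eval_mult: "eval (p * q) f = eval p (eval q f)"
proof (induction p rule: poly_mapping_add_induct)
  case zero
  show ?case by (simp add: eval_zero)
next
  case (add p p')
  then show ?case by (simp add: distrib_right eval_add)
next
  case (single w c)
  interpret w: module_hom scl scl "foldr act (letters w)" by (rule foldr_act_hom)
  show ?case
  proof (induction q rule: poly_mapping_add_induct)
    case zero
    show ?case by (simp add: eval_zero eval_single)
  next
    case (single w' c')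
    show ?case
      by (simp add: mult_single eval_single plus_word_def w.scale mult.commute)
  next
    case (add q q')
    then show ?case
      by (simp add: distrib_left eval_add eval_single w.add scale_right_distrib)
  qed
qed

lemma eval_scale: "eval (Defs.scale c p) f = scl [:c:] (eval p f)"
  by (simp add: scale_conv_mult eval_mult eval_single zero_word_def)

lemma eval_uminus: "eval (- p) f = - eval p f"
  using eval_add[of "- p" p f] by (simp add: eval_zero add_eq_0_iff2)

lemma eval_diff: "eval (p - q) f = eval p f - eval q f"
  using eval_add[of p "- q" f] by (simp add: eval_uminus)

lemma eval_sum: "eval (sum g A) f = (\<Sum>a\<in>A. eval (g a) f)"
  by (induction A rule: infinite_finite_induct) (simp_all add: eval_zero eval_add)

text \<open>The elements of the free algebra that act as zero form an ideal containing
  \<open>S\<close>, hence containing the hull. Thus the action descends to the presented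
  algebra.\<close>

lemma eval_ideal_hull:
  assumes "S \<subseteq> free_algebra X" and S: "\<And>p f. p \<in> S \<Longrightarrow> eval p f = 0"
    and p: "p \<in> algebra_ideal (free_algebra X) hull S"
  shows "eval p f = 0"
proof -
  let ?N = "{p \<in> free_algebra X. \<forall>f. eval p f = 0}"
  have "eval q 0 = 0" for q
    using module_hom.zero[OF eval_hom] .
  then have "algebra_ideal (free_algebra X) ?N"
    by (auto simp: algebra_ideal_def free_algebra_zero free_algebra_add free_algebra_scale
        free_algebra_mult eval_zero eval_add eval_scale eval_mult)
  then have "algebra_ideal (free_algebra X) hull S \<subseteq> ?N"
    using assms by (intro hull_minimal) auto
  with p show ?thesis by auto
qed

end

section \<open>An invertible matrix with prescribed corner\<close>

definition select :: "nat \<Rightarrow> nat \<Rightarrow> (nat \<Rightarrow> 'a) \<Rightarrow> nat \<Rightarrow> 'a" where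
  "select k j g = (\<lambda>a. g (a * k + j))"

definition spread :: "nat \<Rightarrow> nat \<Rightarrow> (nat \<Rightarrow> 'a::zero) \<Rightarrow> nat \<Rightarrow> 'a" where
  "spread k j g = (\<lambda>a. if a mod k = j then g (a div k) else 0)"

lemma select_spread:
  "i < k \<Longrightarrow> j < k \<Longrightarrow> select k i (spread k j g) = (if i = j then g else 0)"
  by (auto simp: select_def spread_def fun_eq_iff)

lemma sum_fun_apply: "(\<Sum>i\<in>A. g i) x = (\<Sum>i\<in>A. g i x)"
  for g :: "'i \<Rightarrow> 'a \<Rightarrow> 'b::comm_monoid_add"
  by (induction A rule: infinite_finite_induct) auto

text \<open>Division with remainder: only the summand \<open>j = a mod k\<close> contributes at
  position \<open>a\<close>.\<close>

lemma sum_spread_select: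
  fixes g :: "nat \<Rightarrow> 'a::comm_monoid_add"
  assumes "0 < k"
  shows "(\<Sum>j<k. spread k j (select k j g)) = g"
proof
  fix a
  have "(\<Sum>j<k. spread k j (select k j g)) a
      = (\<Sum>j<k. if a mod k = j then g (a div k * k + j) else 0)"
    by (simp add: sum_fun_apply spread_def select_def cong: sum.cong if_cong)
  also have "\<dots> = g a"
    using assms by (subst sum.delta') auto
  finally show "(\<Sum>j<k. spread k j (select k j g)) a = g a" .
qed

definition tmul :: "(nat \<Rightarrow> 'k::field poly) \<Rightarrow> nat \<Rightarrow> 'k poly" where
  "tmul g = (\<lambda>a. [:0, 1:] * g a)"

(* The families spread k j (j < k) and select k j (j < k) are the mutually inverse isomorphisms
   between F^k and F. With P the column (select p i) and Q the row (spread q j), fwd is the matrix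
   with blocks (t, Q; P, 0) and bwd its inverse with blocks (0, P'; Q', - t Q' P'), where P' and
   Q' are the inverses of P and Q. The ghost h_ij^* is bwd p q i j: its first index is the
   column. *)

fun fwd :: "nat \<Rightarrow> nat \<Rightarrow> nat \<Rightarrow> nat \<Rightarrow> (nat \<Rightarrow> 'k::field poly) \<Rightarrow> nat \<Rightarrow> 'k poly" where
  "fwd p q 0 0 g = tmul g"
| "fwd p q 0 (Suc j) g = spread q j g"
| "fwd p q (Suc i) 0 g = select p i g"
| "fwd p q (Suc i) (Suc j) g = 0"

fun bwd :: "nat \<Rightarrow> nat \<Rightarrow> nat \<Rightarrow> nat \<Rightarrow> (nat \<Rightarrow> 'k::field poly) \<Rightarrow> nat \<Rightarrow> 'k poly" where
  "bwd p q 0 0 g = 0"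
| "bwd p q 0 (Suc j) g = select q j g"
| "bwd p q (Suc i) 0 g = spread p i g"
| "bwd p q (Suc i) (Suc j) g = - tmul (select q j (spread p i g))"

lemma spread_zero: "spread k j 0 = 0"
  by (auto simp: spread_def)

lemma select_zero: "select k j 0 = 0"
  by (auto simp: select_def)

lemma spread_uminus: "spread k j (- g) = - spread k j g"
  for g :: "nat \<Rightarrow> 'a::group_add"
  by (auto simp: spread_def fun_eq_iff)

lemma spread_tmul: "spread k j (tmul g) = tmul (spread k j g)"
  by (auto simp: spread_def tmul_def fun_eq_iff)

lemma select_tmul: "select k j (tmul g) = tmul (select k j g)"
  by (auto simp: select_def tmul_def)

lemma select_sum: "select k j (sum g A) = (\<Sum>i\<in>A. select k j (g i))"
  by (simp add: select_def sum_fun_apply fun_eq_iff)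

lemma tmul_zero: "tmul 0 = 0"
  by (simp add: tmul_def fun_eq_iff)

lemma tmul_sum: "tmul (sum g A) = (\<Sum>i\<in>A. tmul (g i))"
  by (simp only: tmul_def fun_eq_iff sum_fun_apply sum_distrib_left simp_thms)

text \<open>Block multiplication: Q Q' = 1 and P P' = 1 give the diagonal, and in the block
  \<open>i = 0 < j\<close> the terms t P' and - t Q Q' P' cancel.\<close>

lemma fwd_bwd:
  assumes "0 < q" and "i \<le> p" and "j \<le> p"
  shows "(\<Sum>k\<le>q. fwd p q i k (bwd p q j k g)) = (if i = j then g else 0)"
  using assms
  by (cases i; cases j)
    (auto simp: sum.atMost_shift sum_spread_select select_spread select_zero tmul_zero
      spread_uminus spread_tmul sum_negf simp flip: tmul_sum)

text \<open>Now P' P = 1 and Q' Q = 1 give the diagonal, and in the block \<open>j = 0 < i\<close>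
  the terms t Q' and - t Q' P' P cancel.\<close>

lemma bwd_fwd:
  assumes "0 < p" and "i \<le> q" and "j \<le> q"
  shows "(\<Sum>k\<le>p. bwd p q k i (fwd p q k j g)) = (if i = j then g else 0)"
  using assms
  by (cases i; cases j)
    (auto simp: sum.atMost_shift sum_spread_select select_spread spread_zero select_zero tmul_zero
      select_tmul sum_negf simp flip: tmul_sum select_sum)

section \<open>The representation of the Leavitt path algebra\<close>

definition fscale :: "'r::comm_ring_1 \<Rightarrow> ('v \<Rightarrow> nat \<Rightarrow> 'r) \<Rightarrow> 'v \<Rightarrow> nat \<Rightarrow> 'r" where
  "fscale c f = (\<lambda>v a. c * f v a)"

definition inject :: "'v \<Rightarrow> (nat \<Rightarrow> 'r::zero) \<Rightarrow> 'v \<Rightarrow> nat \<Rightarrow> 'r" where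
  "inject v g = (\<lambda>u a. if u = v then g a else 0)"

lemma inject_apply: "inject v g u = (if u = v then g else 0)"
  by (simp add: inject_def fun_eq_iff)

lemma inject_zero: "inject v 0 = 0"
  by (simp add: inject_def fun_eq_iff)

lemma inject_sum: "(\<Sum>i\<in>A. inject v (g i)) = inject v (sum g A)"
  by (simp add: inject_def fun_eq_iff sum_fun_apply)

text \<open>Each generator reads one factor and writes to one factor, as the vertex relations
  demand. \<open>fwd p q\<close> has p + 1 rows and q + 1 columns, hence the sizes minus 1.\<close>

fun lpa_act :: "('v, 'e) hypergraph_data \<Rightarrow> ('e \<Rightarrow> 'v list) \<Rightarrow> ('e \<Rightarrow> 'v list) \<Rightarrow>
    ('v, 'e) lpa_gen \<Rightarrow> ('v \<Rightarrow> nat \<Rightarrow> 'k::field poly) \<Rightarrow> 'v \<Rightarrow> nat \<Rightarrow> 'k poly" where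
  "lpa_act H sl rl (Vertex u) f = inject u (f u)"
| "lpa_act H sl rl (Edge h i j) f = inject (sl h ! i)
     (fwd (size (hsource H h) - 1) (size (hrange H h) - 1) i j (f (rl h ! j)))"
| "lpa_act H sl rl (Ghost h i j) f = inject (rl h ! j)
     (bwd (size (hsource H h) - 1) (size (hrange H h) - 1) i j (f (sl h ! i)))"

lemma module_fscale: "module (fscale :: 'r::comm_ring_1 \<Rightarrow> _ \<Rightarrow> 'v \<Rightarrow> _)"
  by standard (simp_all add: fscale_def fun_eq_iff algebra_simps)

lemma poly_module_rep_lpa:
  "poly_module_rep fscale (lpa_act H sl rl :: ('v, 'e) lpa_gen \<Rightarrow> _ \<Rightarrow> 'v \<Rightarrow> nat \<Rightarrow> 'k::field poly)"
proof -
  have fwd_add: "fwd p q i j (f + g) = fwd p q i j f + fwd p q i j g"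
    and bwd_add: "bwd p q i j (f + g) = bwd p q i j f + bwd p q i j g"
    and fwd_mult: "fwd p q i j (\<lambda>a. c * f a) = (\<lambda>a. c * fwd p q i j f a)"
    and bwd_mult: "bwd p q i j (\<lambda>a. c * f a) = (\<lambda>a. c * bwd p q i j f a)"
    for p q i j :: nat and c :: "'k poly" and f g
    by (cases i; cases j; simp add: fun_eq_iff select_def spread_def tmul_def algebra_simps)+
  have "module_hom fscale fscale (lpa_act H sl rl x :: ('v \<Rightarrow> nat \<Rightarrow> 'k poly) \<Rightarrow> _)" for x
    unfolding module_hom_def module_hom_axioms_def
    by (cases x)
      (simp_all add: module_fscale inject_def fscale_def fun_eq_iff fwd_add bwd_add
        fwd_mult bwd_mult)
  then show ?thesis
    by (simp add: poly_module_rep_def poly_module_rep_axioms_def module_fscale)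
qed

theorem corollary44:
  fixes K :: "'k::field itself"
    and H :: "('v, 'e) hypergraph_data"
    and sl rl :: "'e \<Rightarrow> 'v list"
  assumes "listed_hypergraph H sl rl"
    and "\<And>h. h \<in> hedges H \<Longrightarrow> size (hsource H h) \<ge> 2 \<and> size (hrange H h) \<ge> 2"
    and "hedges H \<noteq> {}"
  shows "\<not> von_neumann_regular (leavitt_path_algebra K H sl rl)"
proof
  interpret listed_hypergraph H sl rl by fact
  interpret poly_module_rep fscale
    "lpa_act H sl rl :: ('v, 'e) lpa_gen \<Rightarrow> _ \<Rightarrow> 'v \<Rightarrow> nat \<Rightarrow> 'k poly"
    by (rule poly_module_rep_lpa)
  let ?A = "free_algebra (lpa_generators H) :: (('v, 'e) lpa_gen word \<Rightarrow>\<^sub>0 'k) set"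
  define I where "I = algebra_ideal ?A hull lpa_relations H sl rl"
  \<comment> \<open>Sizes of at least 2 make p and q positive, as the two inverse laws
    require.\<close>
  have sizes: "\<exists>p q. size (hsource H h) = Suc p \<and> size (hrange H h) = Suc q \<and> 0 < p \<and> 0 < q"
    if "h \<in> hedges H" for h
    using assms(2)[OF that]
    by (intro exI[of _ "size (hsource H h) - 1"] exI[of _ "size (hrange H h) - 1"]) auto
  have rel: "eval p f = 0" if "p \<in> lpa_relations H sl rl"
    for p :: "('v, 'e) lpa_gen word \<Rightarrow>\<^sub>0 'k" and f
    using that
  proof cases
    case (edge_ghost h i j)
    with sizes[of h] show ?thesis
      by (auto simp: eval_diff eval_sum eval_mult eval_generator eval_zero inject_apply inject_sum
          lessThan_Suc_atMost fwd_bwd inject_zero)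
  next
    case (ghost_edge h i j)
    with sizes[of h] show ?thesis
      by (auto simp: eval_diff eval_sum eval_mult eval_generator eval_zero inject_apply inject_sum
          lessThan_Suc_atMost bwd_fwd inject_zero)
  qed (auto simp: eval_diff eval_mult eval_generator eval_zero inject_apply inject_zero)
  have I: "eval p f = 0" if "p \<in> I" for p f
    using lpa_relations_subset rel that unfolding I_def by (rule eval_ideal_hull)
  have "0 \<in> I"
    using algebra_ideal_hull[OF lpa_relations_subset] unfolding I_def algebra_ideal_def by blast
  obtain h where h: "h \<in> hedges H" using assms(3) by blast
  define x :: "('v, 'e) lpa_gen word \<Rightarrow>\<^sub>0 'k" where "x = edge h 0 0"
  have "x \<in> ?A"
    using sizes[OF h] h
    by (auto simp: x_def lpa_generators_def intro!: free_algebra_generator)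
  moreover assume "von_neumann_regular (leavitt_path_algebra K H sl rl)"
  ultimately obtain y where y: "((x +o I) * (y +o I) + I) * (x +o I) + I = x +o I"
    by (auto simp: von_neumann_regular_def leavitt_path_algebra_def presented_algebra_def
        quotient_algebra_def simp flip: I_def)
  have mem: "p \<in> p +o I" for p
    using \<open>0 \<in> I\<close> by (force simp: elt_set_plus_def)
  \<comment> \<open>Regularity is an equality of cosets; choosing representatives turns it into x y
    x = x + z, where z in \<open>I\<close> acts as zero. The added zeros come from the
    \<open>I\<close> that completes each product.\<close>
  have "(x * y + 0) * x + 0 \<in> ((x +o I) * (y +o I) + I) * (x +o I) + I"
    by (intro set_plus_intro set_times_intro mem \<open>0 \<in> I\<close>)
  then obtain z where z: "z \<in> I" "x * y * x = x + z"
    unfolding y by (auto simp: elt_set_plus_def)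
  \<comment> \<open>With \<open>e\<close> equal to 1 everywhere, x e is t times \<open>g\<close>,
    which puts a factor t to the right of y.\<close>
  define e g :: "'v \<Rightarrow> nat \<Rightarrow> 'k poly"
    where "e = (\<lambda>v a. 1)" and "g = inject (sl h ! 0) (\<lambda>a. 1)"
  have ev_x: "eval x f = inject (sl h ! 0) (tmul (f (rl h ! 0)))" for f
    by (simp add: x_def eval_generator)
  have "eval x e = fscale [:0, 1:] g"
    by (auto simp: ev_x e_def g_def fscale_def inject_def tmul_def fun_eq_iff)
  moreover have "eval x (eval y (eval x e)) = eval x e"
    using I[OF z(1)] z(2) by (simp flip: eval_mult add: mult.assoc[symmetric] eval_add)
  \<comment> \<open>Linearity over K[t] moves this t past y; the outer x will supply a second
    one.\<close>
  ultimately have "eval x (fscale [:0, 1:] (eval y g)) = fscale [:0, 1:] g"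
    by (simp add: module_hom.scale[OF eval_hom])
  then have "eval x (fscale [:0, 1:] (eval y g)) (sl h ! 0) 0 = fscale [:0, 1:] g (sl h ! 0) 0"
    by simp
  then have "[:0, 1:] * ([:0, 1:] * eval y g (rl h ! 0) 0) = [:0, 1:]"
    by (simp add: ev_x fscale_def inject_def tmul_def g_def)
  \<comment> \<open>The coefficient of t is 1 on the right, but the left side is divisible by
    t^2.\<close>
  then have "coeff ([:0, 1:] * ([:0, 1:] * eval y g (rl h ! 0) 0)) 1 = 1"
    by (metis One_nat_def coeff_pCons_Suc lead_coeff_1 degree_1 one_pCons)
  then show False by simp
qed

end
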